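(* Let $\mathcal{D}\subseteq\mathbb{R}^d$, let $\boldsymbol{K}:\mathcal{D}\times\mathcal{D}\to\mathbb{R}^{n\times n}$ be a positive definite kernel and let $X=\{\boldsymbol{x}_1,\dots,\boldsymbol{x}_N\}\subseteq\mathcal{D}$ consist of pairwise distinct points. Let $V_X=\{\sum_{j=1}^N\boldsymbol{K}(\cdot,\boldsymbol{x}_j)\boldsymbol{\beta}_j:\boldsymbol{\beta}_j\in\mathbb{R}^n,\ 1\le j\le N\}$ and let $\mathcal{H}$ be the reproducing kernel Hilbert space of $\boldsymbol{K}$. 1. Given $\lambda>0$ and $\boldsymbol{Y}=(\boldsymbol{y}_1,\dots,\boldsymbol{y}_N)$ with $\boldsymbol{y}_j\in\mathbb{R}^n$, there is a unique function $\boldsymbol{s}_{\lambda,\boldsymbol{Y}}\in V_X$ solving $$\min\Bigl\{\sum_{j=1}^N\|\boldsymbol{s}(\boldsymbol{x}_j)-\boldsymbol{y}_j\|_2^2+\lambda\|\boldsymbol{s}\|_{\mathcal{H}}^2:\boldsymbol{s}\in\mathcal{H}\Bigr\}.$$ This defines an approximation operator $\boldsymbol{Q}_{X,\lambda}$ by $\boldsymbol{Q}_{X,\lambda}\boldsymbol{Y}:=\boldsymbol{s}_{\lambda,\boldsymbol{Y}}$, and also an operator $\boldsymbol{Q}_{X,\lambda}:C(\mathcal{D})^n\to V_X$ by $\boldsymbol{Q}_{X,\lambda}\boldsymbol{v}:=\boldsymbol{Q}_{X,\lambda}(\boldsymbol{v}|X)$, where $\boldsymbol{v}|X=(\boldsymbol{v}(\boldsymbol{x}_1),\dots,\boldsymbol{v}(\boldsymbol{x}_N))$.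 2. Let $\sigma>0$ and let $\boldsymbol{m}_{N,\sigma}$ be the predictive mean with data $\boldsymbol{Y}$, prior mean $\boldsymbol{m}\in C(\mathcal{D})^n$ and prior covariance kernel $\boldsymbol{K}$. Then $\boldsymbol{m}_{N,\sigma}=\boldsymbol{m}-\boldsymbol{Q}_{X,\sigma^2}\boldsymbol{m}+\boldsymbol{Q}_{X,\sigma^2}\boldsymbol{Y}$.
   Context: A continuous map $\boldsymbol{K}:\mathcal{D}\times\mathcal{D}\to\mathbb{R}^{n\times n}$ is positive definite if $\boldsymbol{K}(\boldsymbol{x},\boldsymbol{x}')^{\mathrm T}=\boldsymbol{K}(\boldsymbol{x}',\boldsymbol{x})$ for all $\boldsymbol{x},\boldsymbol{x}'$ and $\sum_{i,j=1}^N\boldsymbol{w}_i^{\mathrm T}\boldsymbol{K}(\boldsymbol{x}_i,\boldsymbol{x}_j)\boldsymbol{w}_j>0$ for all $N$, all pairwise distinct $\boldsymbol{x}_1,\dots,\boldsymbol{x}_N\in\mathcal{D}$ and all $\boldsymbol{w}_1,\dots,\boldsymbol{w}_N\in\mathbb{R}^n$ not all zero. A Hilbert space $\mathcal{H}$ of functions $\mathcal{D}\to\mathbb{R}^n$ is the reproducing kernel Hilbert space of $\boldsymbol{K}$ if $\boldsymbol{K}(\cdot,\boldsymbol{x})\boldsymbol{w}\in\mathcal{H}$ and $\boldsymbol{v}(\boldsymbol{x})^{\mathrm T}\boldsymbol{w}=\langle\boldsymbol{v},\boldsymbol{K}(\cdot,\boldsymbol{x})\boldsymbol{w}\rangle_{\mathcal{H}}$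 for all $\boldsymbol{v}\in\mathcal{H}$, $\boldsymbol{x}\in\mathcal{D}$, $\boldsymbol{w}\in\mathbb{R}^n$. Every positive definite kernel has a unique such space. Block notation: $\boldsymbol{K}(\boldsymbol{x},X)=(\boldsymbol{K}(\boldsymbol{x},\boldsymbol{x}_1),\dots,\boldsymbol{K}(\boldsymbol{x},\boldsymbol{x}_N))\in\mathbb{R}^{n\times nN}$, $\boldsymbol{K}(X,X)=(\boldsymbol{K}(\boldsymbol{x}_i,\boldsymbol{x}_j))_{i,j}\in\mathbb{R}^{nN\times nN}$; $\boldsymbol{m}(X)$ and $\boldsymbol{Y}$ are regarded as column vectors in $\mathbb{R}^{nN}$; $I$ is the identity in $\mathbb{R}^{nN\times nN}$. The predictive mean is $\boldsymbol{m}_{N,\sigma}(\boldsymbol{x})=\boldsymbol{m}(\boldsymbol{x})+\boldsymbol{K}(\boldsymbol{x},X)(\boldsymbol{K}(X,X)+\sigma^2I)^{-1}(\boldsymbol{Y}-\boldsymbol{m}(X))$. *)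

theory Defs
  imports "HOL-Analysis.Analysis"
begin

definition positive_definite_kernel ::
  "(real^'d) set \<Rightarrow> (real^'d \<Rightarrow> real^'d \<Rightarrow> real^'n^'n) \<Rightarrow> bool" where
  "positive_definite_kernel D K \<longleftrightarrow>
     continuous_on (D \<times> D) (\<lambda>(x, y). K x y) \<and>
     (\<forall>x\<in>D. \<forall>y\<in>D. transpose (K x y) = K y x) \<and>
     (\<forall>(N::nat) (z :: nat \<Rightarrow> real^'d) (w :: nat \<Rightarrow> real^'n).
        z ` {..<N} \<subseteq> D \<longrightarrow> inj_on z {..<N} \<longrightarrow> (\<exists>i<N. w i \<noteq> 0) \<longrightarrow>
        (\<Sum>i<N. \<Sum>j<N. w i \<bullet> (K (z i) (z j) *v w j)) > 0)"

definition ip_norm :: "('f \<Rightarrow> 'f \<Rightarrow> real) \<Rightarrow> 'f \<Rightarrow> real" where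
  "ip_norm ip f = sqrt (ip f f)"

text \<open>
  Functions on a set \<open>D\<close> are represented by total functions that vanish outside \<open>D\<close>, so that
  equality of functions on \<open>D\<close> is equality in HOL. A Hilbert space of functions on \<open>D\<close> is then
  a carrier \<open>H\<close> of such functions together with an inner product \<open>ip\<close> on it.
\<close>

locale function_Hilbert_space =
  fixes D :: "'a set" and H :: "('a \<Rightarrow> 'b::real_vector) set"
    and ip :: "('a \<Rightarrow> 'b) \<Rightarrow> ('a \<Rightarrow> 'b) \<Rightarrow> real"
  assumes vanishes_outside: "\<lbrakk>f \<in> H; x \<notin> D\<rbrakk> \<Longrightarrow> f x = 0"
    and zero_mem: "(\<lambda>x. 0) \<in> H"
    and add_mem: "\<lbrakk>f \<in> H; g \<in> H\<rbrakk> \<Longrightarrow> (\<lambda>x. f x + g x) \<in> H"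
    and scale_mem: "f \<in> H \<Longrightarrow> (\<lambda>x. c *\<^sub>R f x) \<in> H"
    and ip_commute: "\<lbrakk>f \<in> H; g \<in> H\<rbrakk> \<Longrightarrow> ip f g = ip g f"
    and ip_add_left: "\<lbrakk>f \<in> H; g \<in> H; h \<in> H\<rbrakk> \<Longrightarrow> ip (\<lambda>x. f x + g x) h = ip f h + ip g h"
    and ip_scale_left: "\<lbrakk>f \<in> H; g \<in> H\<rbrakk> \<Longrightarrow> ip (\<lambda>x. c *\<^sub>R f x) g = c * ip f g"
    and ip_pos: "\<lbrakk>f \<in> H; f \<noteq> (\<lambda>x. 0)\<rbrakk> \<Longrightarrow> ip f f > 0"
    and complete: "Metric_space.mcomplete H (\<lambda>f g. ip_norm ip (\<lambda>x. f x - g x))"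

definition kernel_section ::
  "(real^'d) set \<Rightarrow> (real^'d \<Rightarrow> real^'d \<Rightarrow> real^'n^'n) \<Rightarrow> real^'d \<Rightarrow> real^'n
    \<Rightarrow> (real^'d \<Rightarrow> real^'n)" where
  "kernel_section D K y w = (\<lambda>x. if x \<in> D then K x y *v w else 0)"

locale reproducing_kernel_Hilbert_space = function_Hilbert_space D H ip
  for D :: "(real^'d) set" and K :: "real^'d \<Rightarrow> real^'d \<Rightarrow> real^'n^'n"
    and H :: "(real^'d \<Rightarrow> real^'n) set" and ip +
  assumes kernel_section_mem: "x \<in> D \<Longrightarrow> kernel_section D K x w \<in> H"
    and reproducing: "\<lbrakk>v \<in> H; x \<in> D\<rbrakk> \<Longrightarrow> v x \<bullet> w = ip v (kernel_section D K x w)"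

text \<open>
  The points are a family \<open>X\<close> over a finite index type \<open>'k\<close>, so \<open>N\<close> is \<open>CARD('k)\<close>, and data
  have type \<open>real^'n^'k\<close>.
\<close>

definition kernel_span ::
  "(real^'d) set \<Rightarrow> (real^'d \<Rightarrow> real^'d \<Rightarrow> real^'n^'n) \<Rightarrow> ('k::finite \<Rightarrow> real^'d)
    \<Rightarrow> (real^'d \<Rightarrow> real^'n) set" where
  "kernel_span D K X = {\<lambda>x. \<Sum>j\<in>UNIV. kernel_section D K (X j) (\<beta> j) x | \<beta> :: 'k \<Rightarrow> real^'n. True}"

definition regularized_loss ::
  "((real^'d \<Rightarrow> real^'n) \<Rightarrow> (real^'d \<Rightarrow> real^'n) \<Rightarrow> real) \<Rightarrow> ('k::finite \<Rightarrow> real^'d) \<Rightarrow> real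
    \<Rightarrow> real^'n^'k \<Rightarrow> (real^'d \<Rightarrow> real^'n) \<Rightarrow> real" where
  "regularized_loss ip X lam Y s = (\<Sum>j\<in>UNIV. (norm (s (X j) - Y $ j))\<^sup>2) + lam * (ip_norm ip s)\<^sup>2"

definition solves_regression ::
  "(real^'d \<Rightarrow> real^'n) set \<Rightarrow> ((real^'d \<Rightarrow> real^'n) \<Rightarrow> (real^'d \<Rightarrow> real^'n) \<Rightarrow> real)
    \<Rightarrow> ('k::finite \<Rightarrow> real^'d) \<Rightarrow> real \<Rightarrow> real^'n^'k \<Rightarrow> (real^'d \<Rightarrow> real^'n) \<Rightarrow> bool" where
  "solves_regression H ip X lam Y s \<longleftrightarrow> is_arg_min (regularized_loss ip X lam Y) (\<lambda>s. s \<in> H) s"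

definition regression_op ::
  "(real^'d) set \<Rightarrow> (real^'d \<Rightarrow> real^'d \<Rightarrow> real^'n^'n) \<Rightarrow> (real^'d \<Rightarrow> real^'n) set
    \<Rightarrow> ((real^'d \<Rightarrow> real^'n) \<Rightarrow> (real^'d \<Rightarrow> real^'n) \<Rightarrow> real)
    \<Rightarrow> ('k::finite \<Rightarrow> real^'d) \<Rightarrow> real \<Rightarrow> real^'n^'k \<Rightarrow> (real^'d \<Rightarrow> real^'n)" where
  "regression_op D K H ip X lam Y =
     (THE s. s \<in> kernel_span D K X \<and> solves_regression H ip X lam Y s)"

definition samples :: "('k::finite \<Rightarrow> real^'d) \<Rightarrow> (real^'d \<Rightarrow> real^'n) \<Rightarrow> real^'n^'k" where
  "samples X v = (\<chi> j. v (X j))"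

definition regression_op_fun ::
  "(real^'d) set \<Rightarrow> (real^'d \<Rightarrow> real^'d \<Rightarrow> real^'n^'n) \<Rightarrow> (real^'d \<Rightarrow> real^'n) set
    \<Rightarrow> ((real^'d \<Rightarrow> real^'n) \<Rightarrow> (real^'d \<Rightarrow> real^'n) \<Rightarrow> real)
    \<Rightarrow> ('k::finite \<Rightarrow> real^'d) \<Rightarrow> real \<Rightarrow> (real^'d \<Rightarrow> real^'n) \<Rightarrow> (real^'d \<Rightarrow> real^'n)" where
  "regression_op_fun D K H ip X lam v = regression_op D K H ip X lam (samples X v)"

text \<open>
  Block vectors and matrices of size \<open>nN\<close> are indexed by \<open>'k \<times> 'n\<close>: the first component of an
  index selects the block, the second the entry within the block.
\<close>

definition stack :: "real^'n^'k \<Rightarrow> real^('k::finite \<times> 'n::finite)" where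
  "stack Y = (\<chi> p. Y $ fst p $ snd p)"

definition kernel_row ::
  "(real^'d \<Rightarrow> real^'d \<Rightarrow> real^'n^'n) \<Rightarrow> real^'d \<Rightarrow> ('k::finite \<Rightarrow> real^'d)
    \<Rightarrow> real^('k \<times> 'n::finite)^'n" where
  "kernel_row K x X = (\<chi> a q. K x (X (fst q)) $ a $ snd q)"

definition kernel_matrix ::
  "(real^'d \<Rightarrow> real^'d \<Rightarrow> real^'n^'n) \<Rightarrow> ('k::finite \<Rightarrow> real^'d)
    \<Rightarrow> real^('k \<times> 'n::finite)^('k \<times> 'n)" where
  "kernel_matrix K X = (\<chi> p q. K (X (fst p)) (X (fst q)) $ snd p $ snd q)"

definition predictive_mean ::
  "(real^'d \<Rightarrow> real^'n) \<Rightarrow> (real^'d \<Rightarrow> real^'d \<Rightarrow> real^'n^'n) \<Rightarrow> ('k::finite \<Rightarrow> real^'d)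
    \<Rightarrow> real \<Rightarrow> real^'n^'k \<Rightarrow> real^'d \<Rightarrow> real^'n::finite" where
  "predictive_mean m K X \<sigma> Y x =
     m x + kernel_row K x X *v
       (matrix_inv (kernel_matrix K X + \<sigma>\<^sup>2 *\<^sub>R mat 1) *v (stack Y - stack (samples X m)))"

end

theory Submission
  imports Defs
begin

text \<open>
  Write \<open>s\<close> for the combination of kernel sections with coefficient blocks \<open>c\<close>. By the reproducing
  property \<open>ip h s\<close> is the sum of the \<open>h (X j) \<bullet> c $ j\<close>, so if \<open>c\<close> satisfies the normal equations
  \<open>s (X j) + lam *\<^sub>R c $ j = Y $ j\<close>, then the cross terms in the loss of \<open>s + h\<close> cancel and the loss
  exceeds that of \<open>s\<close> by the sum of the \<open>(norm (h (X j)))\<^sup>2\<close> plus \<open>lam * ip h h\<close>. Hence \<open>s\<close> is the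
  only minimizer over all of \<open>H\<close>. The same identity shows that the matrix of the normal equations
  has trivial null space, because \<open>ip s s\<close> is nonnegative. The formula for
  the predictive mean is then linearity of \<open>s\<close> in \<open>Y\<close>.
\<close>

lemma matrix_inv_right:
  assumes "invertible A"
  shows "A ** matrix_inv A = mat 1"
  using someI_ex[OF assms[unfolded invertible_def]] by (simp add: matrix_inv_def)

section \<open>Inner product algebra in a Hilbert space of functions\<close>

context function_Hilbert_space
begin

lemma diff_mem:
  assumes "f \<in> H" "g \<in> H"
  shows "(\<lambda>x. f x - g x) \<in> H"
  using add_mem[OF assms(1) scale_mem[OF assms(2), of "-1"]] by simp

lemma sum_mem:
  assumes "finite A" "\<And>i. i \<in> A \<Longrightarrow> f i \<in> H"
  shows "(\<lambda>x. \<Sum>i\<in>A. f i x) \<in> H"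
  using assms by (induction A rule: finite_induct) (auto simp: zero_mem intro: add_mem)

lemma ip_zero_left: "g \<in> H \<Longrightarrow> ip (\<lambda>x. 0) g = 0"
  using ip_scale_left[OF zero_mem, of g 0] by simp

lemma ip_nonneg: "f \<in> H \<Longrightarrow> ip f f \<ge> 0"
  using ip_pos[of f] ip_zero_left[OF zero_mem] by (cases "f = (\<lambda>x. 0)") auto

lemma ip_norm_squared: "f \<in> H \<Longrightarrow> (ip_norm ip f)\<^sup>2 = ip f f"
  by (simp add: ip_norm_def ip_nonneg)

lemma ip_add_right:
  assumes "f \<in> H" "g \<in> H" "h \<in> H"
  shows "ip h (\<lambda>x. f x + g x) = ip h f + ip h g"
  using assms by (simp add: ip_commute[of h] add_mem ip_add_left)

lemma ip_sum_right:
  assumes "finite A" "\<And>i. i \<in> A \<Longrightarrow> f i \<in> H" "h \<in> H"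
  shows "ip h (\<lambda>x. \<Sum>i\<in>A. f i x) = (\<Sum>i\<in>A. ip h (f i))"
  using assms
  by (induction A rule: finite_induct)
     (auto simp: ip_commute[of h] ip_zero_left zero_mem ip_add_right sum_mem)

lemma ip_add_self:
  assumes "f \<in> H" "g \<in> H"
  shows "ip (\<lambda>x. f x + g x) (\<lambda>x. f x + g x) = ip f f + 2 * ip g f + ip g g"
  using assms by (simp add: ip_add_left ip_add_right add_mem ip_commute[of f g])

end

text \<open>The coefficients have the same type as the data, unlike the function
  \<open>\<beta>\<close> in \<open>kernel_span\<close>, so that \<open>stack\<close> applies to them
  and they can be added to samples.\<close>

definition kernel_comb ::
  "(real^'d) set \<Rightarrow> (real^'d \<Rightarrow> real^'d \<Rightarrow> real^'n^'n) \<Rightarrow> ('k::finite \<Rightarrow> real^'d)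
    \<Rightarrow> real^'n^'k \<Rightarrow> (real^'d \<Rightarrow> real^'n)" where
  "kernel_comb D K X c = (\<lambda>x. \<Sum>j\<in>UNIV. kernel_section D K (X j) (c $ j) x)"

lemma kernel_comb_in_span: "kernel_comb D K X c \<in> kernel_span D K X"
  unfolding kernel_comb_def kernel_span_def by blast

section \<open>Stacked vectors and products with block matrices\<close>

lemma stack_add: "stack (Y + Z) = stack Y + stack Z"
  and stack_scaleR: "stack (r *\<^sub>R Y) = r *\<^sub>R stack Y"
  and stack_zero: "stack 0 = 0"
  by (simp_all add: stack_def vec_eq_iff)

lemma inj_stack: "inj stack"
  by (auto simp: inj_on_def stack_def vec_eq_iff)

text \<open>Allows any vector produced by matrix algebra to be read back as a family of coefficient
  blocks.\<close>

lemma surj_stack: "surj (stack :: real^'n^'k \<Rightarrow> real^('k::finite \<times> 'n::finite))"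
proof (rule surjI)
  show "stack (\<chi> j a. z $ (j, a)) = z" for z :: "real^('k \<times> 'n)"
    by (simp add: stack_def vec_eq_iff)
qed

text \<open>The sum over index pairs splits into a sum over blocks and one over entries. The point
  must lie in \<open>D\<close> because sections are cut off outside \<open>D\<close>, while
  \<open>kernel_row\<close> is not.\<close>

lemma kernel_row_mult_stack:
  assumes "x \<in> D"
  shows "kernel_row K x X *v stack c = kernel_comb D K X c x"
proof -
  have "(kernel_row K x X *v stack c) $ a = kernel_comb D K X c x $ a" for a
  proof -
    have "(kernel_row K x X *v stack c) $ a =
        (\<Sum>q\<in>UNIV \<times> UNIV. K x (X (fst q)) $ a $ snd q * c $ fst q $ snd q)"
      by (simp add: matrix_vector_mult_def kernel_row_def stack_def)
    also have "\<dots> = kernel_comb D K X c x $ a"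
      using assms
      unfolding sum.cartesian_product'
      by (simp add: kernel_comb_def kernel_section_def matrix_vector_mult_def)
    finally show ?thesis .
  qed
  then show ?thesis
    by (simp add: vec_eq_iff)
qed

lemma kernel_matrix_mult_stack:
  assumes "range X \<subseteq> D"
  shows "kernel_matrix K X *v stack c = stack (samples X (kernel_comb D K X c))"
proof -
  have "(kernel_matrix K X *v stack c) $ p = stack (samples X (kernel_comb D K X c)) $ p" for p
  proof -
    \<comment> \<open>Row \<open>p\<close> of the kernel matrix is row \<open>snd p\<close> of the
      kernel row at the point \<open>X (fst p)\<close>.\<close>
    have "(kernel_matrix K X *v stack c) $ p = (kernel_row K (X (fst p)) X *v stack c) $ snd p"
      by (simp add: matrix_vector_mult_def kernel_row_def kernel_matrix_def)
    also have "\<dots> = stack (samples X (kernel_comb D K X c)) $ p"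
      using assms by (subst kernel_row_mult_stack[where D = D]) (auto simp: stack_def samples_def)
    finally show ?thesis .
  qed
  then show ?thesis
    by (simp add: vec_eq_iff)
qed

text \<open>Translates between the linear system for stacked vectors and the normal equations for
  blocks.\<close>

lemma regularized_matrix_mult_stack:
  assumes "range X \<subseteq> D"
  shows "(kernel_matrix K X + lam *\<^sub>R mat 1) *v stack c =
    stack (samples X (kernel_comb D K X c) + lam *\<^sub>R c)"
  by (simp add: matrix_vector_mult_add_rdistrib scaleR_matrix_vector_assoc[symmetric]
      kernel_matrix_mult_stack[OF assms] stack_add stack_scaleR)

section \<open>Normal equations and minimizers of the regularized loss\<close>

context reproducing_kernel_Hilbert_space
begin

lemma kernel_comb_mem: "range X \<subseteq> D \<Longrightarrow> kernel_comb D K X c \<in> H"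
  unfolding kernel_comb_def by (intro sum_mem kernel_section_mem) auto

lemma ip_kernel_comb:
  assumes "range X \<subseteq> D" "h \<in> H"
  shows "ip h (kernel_comb D K X c) = (\<Sum>j\<in>UNIV. h (X j) \<bullet> c $ j)"
proof -
  have "ip h (kernel_comb D K X c) = (\<Sum>j\<in>UNIV. ip h (kernel_section D K (X j) (c $ j)))"
    unfolding kernel_comb_def
    using assms by (intro ip_sum_right kernel_section_mem) auto
  also have "\<dots> = (\<Sum>j\<in>UNIV. h (X j) \<bullet> c $ j)"
    using assms by (intro sum.cong refl) (auto simp: reproducing[symmetric] image_subset_iff)
  finally show ?thesis .
qed

lemma invertible_regularized_matrix:
  fixes X :: "'k::finite \<Rightarrow> real^'d"
  assumes X: "range X \<subseteq> D" and lam: "lam > 0"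
  shows "invertible (kernel_matrix K X + lam *\<^sub>R mat 1)"
proof -
  let ?A = "kernel_matrix K X + lam *\<^sub>R mat 1 :: real^('k \<times> 'n)^('k \<times> 'n)"
  have "z = 0" if z: "?A *v z = 0" for z
  proof -
    obtain c where c: "z = stack c"
      using surj_stack by (metis surjD)
    let ?s = "kernel_comb D K X c"
    have "samples X ?s + lam *\<^sub>R c = 0"
      using z inj_stack unfolding c regularized_matrix_mult_stack[OF X]
      by (metis injD stack_zero)
    then have s: "?s (X j) = - (lam *\<^sub>R c $ j)" for j
      by (simp add: vec_eq_iff samples_def eq_neg_iff_add_eq_0)
    have "0 \<le> ip ?s ?s"
      by (intro ip_nonneg kernel_comb_mem X)
    \<comment> \<open>Pairing \<open>?s\<close> with itself by \<open>ip_kernel_comb\<close>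
      involves only its samples, which are multiples of the coefficients.\<close>
    also have "\<dots> = - lam * (\<Sum>j\<in>UNIV. (norm (c $ j))\<^sup>2)"
      by (simp add: ip_kernel_comb[OF X kernel_comb_mem[OF X]] s power2_norm_eq_inner
          sum_distrib_left sum_negf)
    finally have "(\<Sum>j\<in>UNIV. (norm (c $ j))\<^sup>2) \<le> 0"
      using lam by (simp add: mult_le_0_iff)
    then have "(\<Sum>j\<in>UNIV. (norm (c $ j))\<^sup>2) = 0"
      by (intro antisym sum_nonneg) auto
    then have "c = 0"
      by (simp add: sum_nonneg_eq_0_iff vec_eq_iff)
    then show ?thesis
      by (simp add: c stack_zero)
  qed
  then show ?thesis
    by (simp add: invertible_left_inverse matrix_left_invertible_ker)
qed

lemma loss_add_eq:
  fixes X :: "'k::finite \<Rightarrow> real^'d"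
  assumes X: "range X \<subseteq> D" and h: "h \<in> H"
    and normal_eq: "samples X (kernel_comb D K X c) + lam *\<^sub>R c = Y"
  shows "regularized_loss ip X lam Y (\<lambda>x. kernel_comb D K X c x + h x) =
    regularized_loss ip X lam Y (kernel_comb D K X c) +
    (\<Sum>j\<in>UNIV. (norm (h (X j)))\<^sup>2) + lam * ip h h"
proof -
  let ?s = "kernel_comb D K X c"
  have Y: "Y $ j = ?s (X j) + lam *\<^sub>R c $ j" for j
    using normal_eq by (auto simp: samples_def)
  \<comment> \<open>By the normal equations the residual \<open>?s (X j) - Y $ j\<close> is
    \<open>- lam *\<^sub>R c $ j\<close>, which determines the cross term.\<close>
  have "(norm (?s (X j) + h (X j) - Y $ j))\<^sup>2 =
      (norm (?s (X j) - Y $ j))\<^sup>2 - 2 * lam * (h (X j) \<bullet> c $ j) + (norm (h (X j)))\<^sup>2" for j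
    unfolding Y power2_norm_eq_inner
    by (simp add: inner_diff_left inner_diff_right inner_add_left inner_add_right
        inner_commute algebra_simps)
  then have "(\<Sum>j\<in>UNIV. (norm (?s (X j) + h (X j) - Y $ j))\<^sup>2) =
      (\<Sum>j\<in>UNIV. (norm (?s (X j) - Y $ j))\<^sup>2) - 2 * lam * ip h ?s +
      (\<Sum>j\<in>UNIV. (norm (h (X j)))\<^sup>2)"
    by (simp add: ip_kernel_comb[OF X h] sum.distrib sum_subtractf sum_distrib_left)
  then show ?thesis
    \<comment> \<open>Expanding \<open>ip\<close> at the sum contributes
      \<open>2 * lam * ip h ?s\<close>, which cancels the cross term of the data part.\<close>
    using X h
    by (simp add: regularized_loss_def ip_norm_squared add_mem kernel_comb_mem ip_add_self
        distrib_left)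
qed

text \<open>Any other member of \<open>H\<close> differs from the combination by a nonzero
  \<open>h\<close>, so \<open>loss_add_eq\<close> makes its loss strictly larger. This gives
  existence, uniqueness and membership in the span at once.\<close>

lemma solves_regression_iff:
  fixes X :: "'k::finite \<Rightarrow> real^'d"
  assumes X: "range X \<subseteq> D" and lam: "lam > 0"
    and normal_eq: "samples X (kernel_comb D K X c) + lam *\<^sub>R c = Y"
  shows "solves_regression H ip X lam Y s \<longleftrightarrow> s = kernel_comb D K X c"
proof -
  let ?s = "kernel_comb D K X c" and ?J = "regularized_loss ip X lam Y"
  have less: "?J ?s < ?J f" if f: "f \<in> H" "f \<noteq> ?s" for f
  proof -
    let ?h = "\<lambda>x. f x - ?s x"
    have h: "?h \<in> H"
      using f X by (intro diff_mem kernel_comb_mem)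
    have "?h \<noteq> (\<lambda>x. 0)"
      using f(2) by (auto simp: fun_eq_iff)
    then have "0 < lam * ip ?h ?h"
      using ip_pos[OF h] lam by simp
    moreover have "0 \<le> (\<Sum>j\<in>UNIV. (norm (?h (X j)))\<^sup>2)"
      by (intro sum_nonneg) simp
    ultimately show ?thesis
      using loss_add_eq[OF X h normal_eq] by simp
  qed
  show ?thesis
    using less kernel_comb_mem[OF X, of c]
    unfolding solves_regression_def is_arg_min_def by (metis less_asym)
qed

text \<open>The first property identifies the minimizer, the second gives its coefficients in closed
  form.\<close>

lemma normal_equations_solution:
  fixes X :: "'k::finite \<Rightarrow> real^'d"
  assumes X: "range X \<subseteq> D" and lam: "lam > 0"
  obtains c where "samples X (kernel_comb D K X c) + lam *\<^sub>R c = Y"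
    and "stack c = matrix_inv (kernel_matrix K X + lam *\<^sub>R mat 1) *v stack Y"
proof -
  let ?A = "kernel_matrix K X + lam *\<^sub>R mat 1 :: real^('k \<times> 'n)^('k \<times> 'n)"
  obtain c where c: "stack c = matrix_inv ?A *v stack Y"
    using surj_stack by (metis surjD)
  have "?A *v stack c = stack Y"
    by (simp add: c matrix_vector_mul_assoc invertible_regularized_matrix[OF X lam]
        matrix_inv_right)
  then have "samples X (kernel_comb D K X c) + lam *\<^sub>R c = Y"
    unfolding regularized_matrix_mult_stack[OF X] using inj_stack by (metis injD)
  then show ?thesis
    using c that by blast
qed

lemma regression_op_eq:
  fixes X :: "'k::finite \<Rightarrow> real^'d"
  assumes "range X \<subseteq> D" "lam > 0" "samples X (kernel_comb D K X c) + lam *\<^sub>R c = Y"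
  shows "regression_op D K H ip X lam Y = kernel_comb D K X c"
  unfolding regression_op_def solves_regression_iff[OF assms]
  by (auto simp: kernel_comb_in_span)

text \<open>This form makes the linear dependence on \<open>Y\<close> visible and matches the
  correction term of the predictive mean.\<close>

lemma regression_op_apply:
  fixes X :: "'k::finite \<Rightarrow> real^'d"
  assumes X: "range X \<subseteq> D" and lam: "lam > 0" and x: "x \<in> D"
  shows "regression_op D K H ip X lam Y x =
    kernel_row K x X *v (matrix_inv (kernel_matrix K X + lam *\<^sub>R mat 1) *v stack Y)"
proof -
  obtain c where c: "samples X (kernel_comb D K X c) + lam *\<^sub>R c = Y"
    "stack c = matrix_inv (kernel_matrix K X + lam *\<^sub>R mat 1) *v stack Y"
    using normal_equations_solution[OF X lam] .
  show ?thesis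
    unfolding regression_op_eq[OF X lam c(1)] c(2)[symmetric]
    using x by (simp add: kernel_row_mult_stack)
qed

end

theorem theorem3p11:
  fixes D :: "(real^'d) set"
    and K :: "real^'d \<Rightarrow> real^'d \<Rightarrow> real^'n^'n"
    and H :: "(real^'d \<Rightarrow> real^'n) set"
    and ip :: "(real^'d \<Rightarrow> real^'n) \<Rightarrow> (real^'d \<Rightarrow> real^'n) \<Rightarrow> real"
    and X :: "'k::finite \<Rightarrow> real^'d"
  assumes "positive_definite_kernel D K"
    and "reproducing_kernel_Hilbert_space D K H ip"
    and "inj X" and "range X \<subseteq> D"
  shows
    "(\<forall>lam>0.
        (\<forall>Y :: real^'n^'k.
           (\<exists>!s. s \<in> kernel_span D K X \<and> solves_regression H ip X lam Y s) \<and>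
           (\<forall>s. solves_regression H ip X lam Y s \<longrightarrow> s \<in> kernel_span D K X) \<and>
           regression_op D K H ip X lam Y \<in> kernel_span D K X \<and>
           solves_regression H ip X lam Y (regression_op D K H ip X lam Y)) \<and>
        (\<forall>v. continuous_on D v \<longrightarrow> regression_op_fun D K H ip X lam v \<in> kernel_span D K X)) \<and>
     (\<forall>\<sigma>>0. \<forall>(m :: real^'d \<Rightarrow> real^'n) (Y :: real^'n^'k). continuous_on D m \<longrightarrow>
        (\<forall>x\<in>D. predictive_mean m K X \<sigma> Y x =
           m x - regression_op_fun D K H ip X (\<sigma>\<^sup>2) m x + regression_op D K H ip X (\<sigma>\<^sup>2) Y x))"
proof -
  interpret reproducing_kernel_Hilbert_space D K H ip
    by fact
  note X = \<open>range X \<subseteq> D\<close>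
  have regression: "(\<exists>!s. s \<in> kernel_span D K X \<and> solves_regression H ip X lam Y s) \<and>
      (\<forall>s. solves_regression H ip X lam Y s \<longrightarrow> s \<in> kernel_span D K X) \<and>
      regression_op D K H ip X lam Y \<in> kernel_span D K X \<and>
      solves_regression H ip X lam Y (regression_op D K H ip X lam Y)"
    if lam: "lam > 0" for lam and Y :: "real^'n^'k"
  proof -
    obtain c where c: "samples X (kernel_comb D K X c) + lam *\<^sub>R c = Y"
      using normal_equations_solution[OF X lam] by blast
    show ?thesis
      unfolding solves_regression_iff[OF X lam c] regression_op_eq[OF X lam c]
      by (auto simp: kernel_comb_in_span)
  qed
  have "predictive_mean m K X \<sigma> Y x =
      m x - regression_op_fun D K H ip X (\<sigma>\<^sup>2) m x + regression_op D K H ip X (\<sigma>\<^sup>2) Y x"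
    if "\<sigma> > 0" "x \<in> D" for \<sigma> m x and Y :: "real^'n^'k"
    \<comment> \<open>With \<open>lam\<close> equal to \<open>\<sigma>\<^sup>2\<close>, the matrix
      products distribute over \<open>stack Y - stack (samples X m)\<close>, giving the two operator
      values.\<close>
    using that
    by (simp add: predictive_mean_def regression_op_fun_def regression_op_apply[OF X]
        matrix_vector_mult_diff_distrib)
  with regression show ?thesis
    by (simp add: regression_op_fun_def)
qed

end
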